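(* Let $f\in\mathbb{F}_2[x]$ be a nonzero polynomial with $x(x+1)\mid f$, and let $D=\{f_1,f_2,\ldots,f_k\}$ ($k\ge1$) be a set of divisors of $f$ with $f\notin D$ such that the gcd-graph $G_f(D)$ is connected. Let $\overline{D}=\{\gcd(f_i,x(x+1)) : f_i\in D\}$. Then $G_f(D)$ is bipartite if and only if $|\overline{D}|=2$.
   Context: For a nonzero $f\in\mathbb{F}_2[x]$ and a set $D$ of divisors of $f$ with $f\notin D$, the gcd-graph $G_f(D)$ is the undirected loopless graph with vertex set the ring $\mathbb{F}_2[x]/(f)$ in which two vertices $u,v$ are adjacent if and only if $\gcd(u-v,f)\in D$ (with $\gcd(0,f)=f$). *)

theory Defs
  imports
    "HOL-Library.Z2"
    "HOL-Computational_Algebra.Computational_Algebra"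
    "HOL-Computational_Algebra.Field_as_Ring"
    "Graph_Theory.Graph_Theory"
begin

text \<open>
  The field with two elements is the type \<^typ>\<open>bit\<close>. The instances below are what the library
  needs in order to provide \<^const>\<open>gcd\<close> on \<^typ>\<open>bit poly\<close>.
\<close>

instantiation bit ::
  "{unique_euclidean_ring, normalization_euclidean_semiring, normalization_semidom_multiplicative}"
begin

definition [simp]: "normalize_bit = (normalize_field :: bit \<Rightarrow> _)"
definition [simp]: "unit_factor_bit = (unit_factor_field :: bit \<Rightarrow> _)"
definition [simp]: "euclidean_size_bit = (euclidean_size_field :: bit \<Rightarrow> _)"
definition [simp]: "division_segment (x :: bit) = 1"

instance
  by standard
    (simp_all add: dvd_field_iff field_split_simps split: if_splits)

end

instantiation bit :: euclidean_ring_gcd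
begin

definition gcd_bit :: "bit \<Rightarrow> bit \<Rightarrow> bit" where
  "gcd_bit = Euclidean_Algorithm.gcd"
definition lcm_bit :: "bit \<Rightarrow> bit \<Rightarrow> bit" where
  "lcm_bit = Euclidean_Algorithm.lcm"
definition Gcd_bit :: "bit set \<Rightarrow> bit" where
  "Gcd_bit = Euclidean_Algorithm.Gcd"
definition Lcm_bit :: "bit set \<Rightarrow> bit" where
  "Lcm_bit = Euclidean_Algorithm.Lcm"

instance
  by standard (simp_all add: gcd_bit_def lcm_bit_def Gcd_bit_def Lcm_bit_def)

end

instance bit :: field_gcd ..

text \<open>
  Every nonzero polynomial over \<^typ>\<open>bit\<close> is monic, so gcds are unique and \<open>gcd 0 f = f\<close> holds
  without normalization.
\<close>

lemma normalize_bit_poly: "normalize p = p" for p :: "bit poly"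
  by (cases "lead_coeff p") (auto simp: normalize_poly_eq_map_poly map_poly_idI)

text \<open>
  The elements of \<open>\<bbbF>\<^sub>2[x]/(f)\<close>, as residue classes of polynomials modulo \<open>f\<close>.
\<close>

definition mod_rel :: "bit poly \<Rightarrow> (bit poly \<times> bit poly) set" where
  "mod_rel f = {(p, q). f dvd p - q}"

definition residue_classes :: "bit poly \<Rightarrow> bit poly set set" where
  "residue_classes f = UNIV // mod_rel f"

text \<open>
  Undirected graphs are symmetric digraphs, as in the Graph Theory library. Adjacency of two
  residue classes does not depend on the representatives, see \<open>gcd_graph_arc_iff\<close> below.
\<close>

definition gcd_graph :: "bit poly \<Rightarrow> bit poly set \<Rightarrow> bit poly set pair_pre_digraph" where
  "gcd_graph f D =
    \<lparr> pverts = residue_classes f,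
      parcs = {(U, V). U \<in> residue_classes f \<and> V \<in> residue_classes f \<and>
                       (\<exists>u\<in>U. \<exists>v\<in>V. gcd (u - v) f \<in> D)} \<rparr>"

definition bipartite :: "('a, 'b) pre_digraph \<Rightarrow> bool" where
  "bipartite G \<longleftrightarrow>
    (\<exists>A B. verts G = A \<union> B \<and> A \<inter> B = {} \<and> arcs_ends G \<subseteq> A \<times> B \<union> B \<times> A)"

lemma equiv_mod_rel: "equiv UNIV (mod_rel f)"
proof (rule equivI)
  show "refl (mod_rel f)"
    by (auto simp: refl_on_def mod_rel_def)
  show "sym (mod_rel f)"
    by (auto simp: sym_def mod_rel_def dvd_diff_commute)
  show "trans (mod_rel f)"
  proof (rule transI)
    fix p q r
    assume "(p, q) \<in> mod_rel f" "(q, r) \<in> mod_rel f"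
    then have "f dvd (p - q) + (q - r)"
      unfolding mod_rel_def mem_Collect_eq case_prod_conv by (rule dvd_add)
    then show "(p, r) \<in> mod_rel f"
      by (simp add: mod_rel_def)
  qed
qed auto

lemma gcd_diff_cong:
  assumes "(u, u') \<in> mod_rel f" "(v, v') \<in> mod_rel f"
  shows "gcd (u - v) f = gcd (u' - v') f"
proof -
  have "f dvd (u - u') - (v - v')"
    using assms unfolding mod_rel_def by (auto intro: dvd_diff)
  then obtain k where k: "(u - u') - (v - v') = f * k"
    by (elim dvdE)
  then have "u - v = k * f + (u' - v')"
    by (simp add: algebra_simps)
  then show ?thesis
    by (metis gcd.commute gcd_add_mult)
qed

lemma gcd_graph_arc_iff:
  "(mod_rel f `` {u}, mod_rel f `` {v}) \<in> parcs (gcd_graph f D) \<longleftrightarrow> gcd (u - v) f \<in> D"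
proof -
  have "mod_rel f `` {p} \<in> residue_classes f" for p
    by (auto simp: residue_classes_def intro: quotientI)
  moreover have "p \<in> mod_rel f `` {p}" for p
    by (simp add: mod_rel_def)
  ultimately show ?thesis
    by (auto simp: gcd_graph_def gcd_diff_cong)
qed

lemma residue_class_reduce: "mod_rel f `` {p} = mod_rel f `` {p mod f}"
proof (rule equiv_class_eq[OF equiv_mod_rel])
  show "(p, p mod f) \<in> mod_rel f"
    by (simp add: mod_rel_def minus_mod_eq_mult_div)
qed

lemma finite_residue_classes:
  assumes "f \<noteq> 0"
  shows "finite (residue_classes f)"
proof -
  let ?R = "{p :: bit poly. degree p \<le> degree f}"
  have "UNIV = {0, 1 :: bit}"
    by (auto intro: bit.exhaust)
  then have fin: "finite (UNIV :: bit set)"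
    by (metis finite.emptyI finite.insertI)
  have "?R \<subseteq> Poly ` {xs. set xs \<subseteq> UNIV \<and> length xs \<le> Suc (degree f)}"
  proof
    fix p :: "bit poly"
    assume "p \<in> ?R"
    then have "length (coeffs p) \<le> Suc (degree f)"
      by (cases "p = 0") (auto simp: length_coeffs_degree)
    moreover have "p = Poly (coeffs p)"
      by simp
    ultimately show "p \<in> Poly ` {xs. set xs \<subseteq> UNIV \<and> length xs \<le> Suc (degree f)}"
      by blast
  qed
  then have "finite ?R"
    using finite_lists_length_le[OF fin] finite_subset by blast
  moreover have "residue_classes f \<subseteq> (\<lambda>p. mod_rel f `` {p}) ` ?R"
  proof
    fix U
    assume "U \<in> residue_classes f"
    then obtain p where "U = mod_rel f `` {p}"
      by (auto simp: residue_classes_def elim: quotientE)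
    then have "U = mod_rel f `` {p mod f}"
      using residue_class_reduce by simp
    moreover have "p mod f \<in> ?R"
      using degree_mod_less[OF assms, of p] by auto
    ultimately show "U \<in> (\<lambda>p. mod_rel f `` {p}) ` ?R"
      by blast
  qed
  ultimately show ?thesis
    using finite_subset by blast
qed

lemma pair_graph_gcd_graph:
  assumes "f \<noteq> 0" "f \<notin> D"
  shows "pair_graph (gcd_graph f D)"
proof -
  let ?V = "residue_classes f"
  have fin: "finite ?V"
    by (rule finite_residue_classes) fact
  have sub: "parcs (gcd_graph f D) \<subseteq> ?V \<times> ?V"
    by (auto simp: gcd_graph_def)
  have loopfree: "U \<noteq> V" if arc: "(U, V) \<in> parcs (gcd_graph f D)" for U V
  proof
    assume "U = V"
    with arc obtain u where "U = mod_rel f `` {u}" "V = mod_rel f `` {u}"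
      by (auto simp: gcd_graph_def residue_classes_def elim: quotientE)
    with arc have "gcd (u - u) f \<in> D"
      using gcd_graph_arc_iff by simp
    with assms show False
      by (simp add: normalize_bit_poly)
  qed
  have sym: "(V, U) \<in> parcs (gcd_graph f D)" if "(U, V) \<in> parcs (gcd_graph f D)" for U V
  proof -
    have "gcd (v - u) f = gcd (u - v) f" for u v
      by (metis gcd_neg1 minus_diff_eq)
    with that show ?thesis
      by (auto simp: gcd_graph_def) metis
  qed
  show ?thesis
  proof
    show "finite (pverts (gcd_graph f D))"
      using fin by (simp add: gcd_graph_def)
    show "finite (parcs (gcd_graph f D))"
      using sub fin finite_subset by blast
    show "symmetric (with_proj (gcd_graph f D))"
      using sym by (auto simp: symmetric_def intro: symI)
  next
    fix e
    assume "e \<in> parcs (gcd_graph f D)"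
    then show "fst e \<in> pverts (gcd_graph f D)" "snd e \<in> pverts (gcd_graph f D)"
      "fst e \<noteq> snd e"
      using loopfree by (cases e; auto simp: gcd_graph_def)+
  qed
qed

end

theory Submission
  imports Defs "HOL-Library.Product_Plus"
begin

text \<open>
  The gcd-graph is a Cayley graph: two classes are adjacent when their difference lies in the set
  \<open>S\<close> of all \<open>s\<close> with \<open>gcd s f \<in> D\<close>. It is connected when \<open>S\<close> spans the additive group of the
  quotient ring, and it is bipartite when the ring has a colouring by two colours that every
  \<open>s \<in> S\<close> flips (\<open>bipartite_gcd_graph_iff\<close>).

  Everything is decided by the two evaluations of a polynomial at \<open>0\<close> and at \<open>1\<close>, that is, by its
  image in \<open>\<bbbF>\<^sub>2[x]/(x(x + 1))\<close>, a plane over \<open>\<bbbF>\<^sub>2\<close>. This pair determines \<open>gcd d (x(x + 1))\<close> and is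
  determined by it, so the question is about the size of the image \<open>R\<close> of \<open>D\<close> in the plane. As \<open>S\<close>
  spans the ring, \<open>R\<close> spans the plane. If \<open>|R| = 2\<close>, then \<open>R\<close> consists of two of the three nonzero
  points; it is the complement of the line through \<open>0\<close> and the third one, and colouring each
  polynomial by whether its pair lies on that line gives a bipartition.

  Conversely, a colouring flipped by \<open>S\<close> takes the same value on polynomials with the same pair
  (\<open>colouring_factors_through_residues\<close>). The reason is that \<open>S\<close> is closed under multiplication by
  units of the quotient ring, while every multiple of \<open>x(x + 1)\<close> is a sum of two such units
  (\<open>multiple_of_xx1_eq_sum_of_two_units\<close>): a residue field with at least three elements always leaves
  room for a nonzero value that differs from a given one, and the only residue fields with two
  elements are those at \<open>x\<close> and \<open>x + 1\<close>. So adding \<open>x(x + 1)s\<close> with \<open>s \<in> S\<close> amounts to two flips, and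
  these elements span, modulo \<open>f\<close>, all multiples of \<open>x(x + 1)\<close>. Once the colour depends on the pair only, \<open>0 \<in> R\<close>
  is impossible since a single flip would change nothing, and \<open>R\<close> cannot contain all three nonzero
  points since their sum is \<open>0\<close> and three flips are one flip.
\<close>

section \<open>Polynomials over the field with two elements\<close>

text \<open>
  Characteristic two is put into the simplifier, so that differences become sums and signs vanish.
\<close>

lemma bit_poly_add_self [simp]: "p + p = 0" for p :: "bit poly"
proof (rule poly_eqI)
  fix n
  show "coeff (p + p) n = coeff 0 n"
    by (cases "coeff p n") (simp_all only: coeff_add coeff_0, simp_all)
qed

lemma bit_poly_2 [simp]: "(2 :: bit poly) = 0"
  using bit_poly_add_self[of 1] by (simp only: one_add_one)

lemma bit_poly_uminus [simp]: "- p = p" for p :: "bit poly"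
  by (rule poly_eqI) simp

lemma bit_poly_diff [simp]: "p - q = p + q" for p q :: "bit poly"
  by (rule poly_eqI) simp

definition xx1 :: "bit poly" where
  "xx1 = [:0, 1:] * ([:0, 1:] + 1)"

lemma poly_xx1 [simp]: "poly xx1 a = 0"
  by (cases a) (simp_all add: xx1_def)

lemma bit_pair_add_eq_0_iff: "a + b = 0 \<longleftrightarrow> a = b" for a b :: "bit \<times> bit"
  by (cases a; cases b) (auto simp: zero_prod_def)

text \<open>The subgroup \<open>{0, e}\<close> has index two, so adding an element outside swaps its two cosets.\<close>

lemma bit_pair_add_in_subgroup_iff:
  fixes a e v :: "bit \<times> bit"
  assumes "e \<noteq> 0" "a \<notin> {0, e}"
  shows "v + a \<in> {0, e} \<longleftrightarrow> v \<notin> {0, e}"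
  using assms by (cases a; cases e; cases v) (auto simp: zero_prod_def)

text \<open>
  The pair of residues modulo \<open>x\<close> and \<open>x + 1\<close>: by the Chinese remainder theorem, the class
  modulo \<open>x(x + 1)\<close>.
\<close>

definition residues :: "bit poly \<Rightarrow> bit \<times> bit" where
  "residues p = (poly p 0, poly p 1)"

lemma xx1_dvd_iff_residues: "xx1 dvd p \<longleftrightarrow> residues p = 0"
proof
  assume "xx1 dvd p"
  then show "residues p = 0"
    by (auto simp: residues_def zero_prod_def elim!: dvdE)
next
  assume "residues p = 0"
  then have 0: "poly p 0 = 0" and 1: "poly p 1 = 0"
    by (simp_all add: residues_def zero_prod_def)
  from 0 obtain q where q: "p = [:0, 1:] * q"
    by (auto simp: poly_eq_0_iff_dvd elim!: dvdE)
  with 1 have "poly q 1 = 0"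
    by simp
  then have "[:1, 1:] dvd q"
    by (simp add: poly_eq_0_iff_dvd)
  moreover have "[:0, 1:] + 1 = ([:1, 1:] :: bit poly)"
    by (simp add: one_pCons)
  ultimately show "xx1 dvd p"
    unfolding q xx1_def by (simp only: mult_dvd_mono dvd_refl)
qed

lemma residues_add: "residues (p + q) = residues p + residues q"
  by (simp add: residues_def)

lemma residues_eq_iff: "residues p = residues q \<longleftrightarrow> xx1 dvd p + q"
  unfolding xx1_dvd_iff_residues residues_add by (simp add: bit_pair_add_eq_0_iff)

text \<open>
  The two linear factors are told apart by the gcd, and over \<open>\<bbbF>\<^sub>2\<close> a value is known once it is known
  whether it vanishes. This turns the set of gcds of the theorem into a set of points of the plane.
\<close>

lemma gcd_xx1_eq_iff: "gcd p xx1 = gcd q xx1 \<longleftrightarrow> residues p = residues q"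
proof
  assume eq: "gcd p xx1 = gcd q xx1"
  have dvd: "c dvd p \<longleftrightarrow> c dvd q" if "c dvd xx1" for c
    using that eq by (metis gcd_greatest_iff)
  have root: "poly p a = 0 \<longleftrightarrow> poly q a = 0" for a
    using dvd[of "[:-a, 1:]"] poly_xx1[of a] by (simp only: poly_eq_0_iff_dvd)
  show "residues p = residues q"
    using root[of 0] root[of 1] unfolding residues_def
    by (cases "poly p 0"; cases "poly q 0"; cases "poly p 1"; cases "poly q 1") simp_all
next
  assume "residues p = residues q"
  then obtain k where "p + q = xx1 * k"
    unfolding residues_eq_iff by (elim dvdE)
  then have "p = k * xx1 + q"
    by (metis add.assoc add.right_neutral bit_poly_add_self mult.commute)
  then show "gcd p xx1 = gcd q xx1"
    by (metis gcd.commute gcd_add_mult)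
qed

lemma residues_gcd:
  assumes "xx1 dvd f"
  shows "residues (gcd s f) = residues s"
  using assms unfolding gcd_xx1_eq_iff[symmetric]
  by (metis gcd.assoc gcd_proj2_iff normalize_bit_poly)

lemma card_image_gcd_xx1: "card ((\<lambda>d. gcd d xx1) ` D) = card (residues ` D)"
proof -
  have "bij_betw (\<lambda>g. residues g) ((\<lambda>d. gcd d xx1) ` D) (residues ` D)"
  proof -
    have "residues (gcd d xx1) = residues d" for d
      by (simp flip: gcd_xx1_eq_iff)
    then show ?thesis
      by (auto simp: bij_betw_def inj_on_def image_image gcd_xx1_eq_iff)
  qed
  then show ?thesis
    by (rule bij_betw_same_card)
qed

section \<open>Sums of two units\<close>

text \<open>
  The inductive step for finding the units. Modulo \<open>p\<close> the candidates \<open>u + g * t\<close> with \<open>t = 0, 1, x\<close>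
  have to avoid the classes of \<open>0\<close> and of \<open>r\<close>. If \<open>p\<close> divides \<open>r\<close>, the two classes coincide, and one of
  \<open>t = 0, 1\<close> is good. Otherwise \<open>p\<close> is neither \<open>x\<close> nor \<open>x + 1\<close>; then the three candidates lie in
  different classes, because their differences are \<open>g\<close> times \<open>1\<close>, \<open>x\<close> or \<open>x + 1\<close>, and two forbidden
  classes cannot hold them all.
\<close>

lemma shift_avoiding_prime:
  fixes p g u r :: "bit poly"
  assumes p: "prime p" and g: "\<not> p dvd g" and r: "xx1 dvd r"
  shows "\<exists>t. \<not> p dvd u + g * t \<and> \<not> p dvd u + g * t + r"
proof (rule ccontr)
  assume "\<not> ?thesis"
  then have bad: "p dvd u + g * t \<or> p dvd u + g * t + r" for t
    by blast
  have cancel: "p dvd s + t" if "p dvd u + g * s + z" "p dvd u + g * t + z" for s t z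
  proof -
    have "u + g * s + z + (u + g * t + z) = g * (s + t) + (u + u) + (z + z)"
      by (simp only: algebra_simps)
    then have "p dvd g * (s + t)"
      using dvd_add[OF that] by simp
    then show ?thesis
      using p g by (simp add: prime_dvd_mult_iff)
  qed
  have cancel0: "p dvd s + t" if "p dvd u + g * s" "p dvd u + g * t" for s t
    using cancel[of s 0 t] that by simp
  have one: "\<not> p dvd 1"
    using p by (simp add: not_prime_unit)
  show False
  proof (cases "p dvd r")
    case True
    then have all: "p dvd u + g * t" for t
      using bad[of t] by (auto simp: dvd_add_left_iff)
    have "p dvd 0 + 1"
      by (rule cancel0[OF all all])
    then show False
      using one by simp
  next
    case False
    then have "\<not> p dvd xx1"
      using r dvd_trans by blast
    then have "\<not> p dvd [:0, 1:]" "\<not> p dvd [:0, 1:] + 1"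
      unfolding xx1_def
      by (meson dvd_mult dvd_mult2)+
    then show False
      using bad[of 0] bad[of 1] bad[of "[:0, 1:]"] one
        cancel[of 0 r 1] cancel[of 0 r "[:0, 1:]"] cancel[of "[:0, 1:]" r 1]
        cancel0[of 0 1] cancel0[of 0 "[:0, 1:]"] cancel0[of "[:0, 1:]" 1]
      by (simp only: add_0) blast
  qed
qed

text \<open>
  Since \<open>r = u + (u + r)\<close>, this writes \<open>r\<close> as a sum of two units modulo \<open>f\<close>. The primes of \<open>f\<close> are dealt
  with one at a time: moving \<open>u\<close> by a multiple of the part \<open>g\<close> that is already done keeps coprimality
  to \<open>g\<close>.
\<close>

lemma multiple_of_xx1_eq_sum_of_two_units:
  fixes f r :: "bit poly"
  assumes "f \<noteq> 0" and r: "xx1 dvd r"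
  shows "\<exists>u. coprime u f \<and> coprime (u + r) f"
  using \<open>f \<noteq> 0\<close>
proof (induction f rule: prime_divisors_induct)
  case zero
  then show ?case by simp
next
  case (unit f)
  then show ?case
    by (metis coprime_commute is_unit_left_imp_coprime)
next
  case (factor p g)
  then obtain u where u: "coprime u g" "coprime (u + r) g"
    by auto
  show ?case
  proof (cases "p dvd g")
    case True
    then have "coprime v p" if "coprime v g" for v
      using that coprime_divisors[OF dvd_refl] by blast
    then show ?thesis
      using u by auto
  next
    case False
    then obtain t where t: "\<not> p dvd u + g * t" "\<not> p dvd u + g * t + r"
      using shift_avoiding_prime[OF \<open>prime p\<close> _ r] by blast
    have shift: "coprime (v + g * t) g \<longleftrightarrow> coprime v g" for v
      by (metis coprime_iff_gcd_eq_1 add.commute gcd.commute gcd_add_mult mult.commute)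
    have "coprime v p" if "\<not> p dvd v" for v
      using \<open>prime p\<close> that by (metis coprime_commute prime_imp_coprime)
    then have "coprime (u + g * t) (p * g)" "coprime (u + g * t + r) (p * g)"
      using t u shift[of u] shift[of "u + r"] by (simp_all add: algebra_simps)
    then show ?thesis
      by blast
  qed
qed

text \<open>So the set of all \<open>s\<close> with \<open>gcd s f \<in> D\<close> contains all multiples of \<open>d \<in> D\<close> by units modulo \<open>f\<close>.\<close>

lemma gcd_mult_unit:
  fixes d u f :: "bit poly"
  assumes "d dvd f" "coprime u f"
  shows "gcd (d * u) f = d"
proof -
  obtain h where h: "f = d * h"
    using assms(1) by (elim dvdE)
  with assms(2) have "coprime u h"
    by simp
  then show ?thesis
    unfolding h gcd_mult_left by (simp add: normalize_bit_poly)
qed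

section \<open>Connectedness and bipartiteness in algebraic terms\<close>

lemma residue_classesE:
  assumes "U \<in> residue_classes f"
  obtains u where "U = mod_rel f `` {u}"
  using assms by (auto simp: residue_classes_def elim: quotientE)

lemma class_in_residue_classes: "mod_rel f `` {u} \<in> residue_classes f"
  by (auto simp: residue_classes_def intro: quotientI)

lemma class_eq_iff: "mod_rel f `` {u} = mod_rel f `` {v} \<longleftrightarrow> f dvd u + v"
  by (subst eq_equiv_class_iff[OF equiv_mod_rel]) (auto simp: mod_rel_def)

text \<open>
  A walk from the class of \<open>0\<close> adds one element of the connection set per step. So connectedness says
  that every polynomial is, modulo \<open>f\<close>, a sum of such elements; here this is an induction principle.
\<close>

lemma connected_gcd_graph_induct [consumes 3, case_names zero add cong]:
  assumes "f \<noteq> 0" "f \<notin> D"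
    and conn: "Digraph_Component.connected (with_proj (gcd_graph f D))"
    and zero: "P 0"
    and add: "\<And>p s. P p \<Longrightarrow> gcd s f \<in> D \<Longrightarrow> P (p + s)"
    and cong: "\<And>p k. P p \<Longrightarrow> P (p + f * k)"
  shows "P p"
proof -
  let ?G = "with_proj (gcd_graph f D)"
  let ?c = "\<lambda>p. mod_rel f `` {p}"
  interpret pair_graph "gcd_graph f D"
    by (rule pair_graph_gcd_graph) fact+
  have "strongly_connected ?G"
    using conn by (intro symmetric_connected_imp_strongly_connected) auto
  then have "?c 0 \<rightarrow>\<^sup>*\<^bsub>?G\<^esub> ?c p"
    unfolding strongly_connected_def
    by (simp add: gcd_graph_def class_in_residue_classes)
  then have "\<forall>q. ?c p = ?c q \<longrightarrow> P q"
  proof (induction rule: reachable_induct)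
    case base
    show ?case
      using cong[OF zero] by (auto simp: class_eq_iff elim!: dvdE)
  next
    case (step U V)
    have arc: "(U, V) \<in> parcs (gcd_graph f D)"
      using step.hyps by simp
    then obtain u where u: "U = ?c u"
      by (auto simp: gcd_graph_def elim!: residue_classesE)
    show ?case
    proof (intro allI impI)
      fix q assume "V = ?c q"
      with arc u have "gcd (u + q) f \<in> D"
        using gcd_graph_arc_iff[of f u q D] by simp
      moreover have "P u"
        using step.IH u by blast
      ultimately have "P (u + (u + q))"
        by (intro add)
      then show "P q"
        by (simp flip: add.assoc)
    qed
  qed
  then show ?thesis
    by blast
qed

lemma bipartite_gcd_graph_iff:
  "bipartite (with_proj (gcd_graph f D)) \<longleftrightarrow>
    (\<exists>c. (\<forall>p s. gcd s f \<in> D \<longrightarrow> c (p + s) = (\<not> c p)) \<and> (\<forall>p k. c (p + f * k) = c p))"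
proof
  let ?c = "\<lambda>p. mod_rel f `` {p}"
  assume "bipartite (with_proj (gcd_graph f D))"
  then obtain A B where AB: "residue_classes f = A \<union> B" "A \<inter> B = {}"
      "parcs (gcd_graph f D) \<subseteq> A \<times> B \<union> B \<times> A"
    unfolding bipartite_def by (auto simp: gcd_graph_def)
  have "?c (p + s) \<in> A \<longleftrightarrow> ?c p \<notin> A" if "gcd s f \<in> D" for p s
  proof -
    have "p - (p + s) = s"
      by (simp flip: add.assoc)
    with that have "(?c p, ?c (p + s)) \<in> parcs (gcd_graph f D)"
      by (simp only: gcd_graph_arc_iff)
    then show ?thesis
      using AB by blast
  qed
  moreover have "?c (p + f * k) = ?c p" for p k
  proof -
    have "p + f * k + p = f * k"
      by (metis add.commute add.left_commute add.right_neutral bit_poly_add_self)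
    then show ?thesis
      unfolding class_eq_iff by simp
  qed
  ultimately show "\<exists>c. (\<forall>p s. gcd s f \<in> D \<longrightarrow> c (p + s) = (\<not> c p)) \<and> (\<forall>p k. c (p + f * k) = c p)"
    by (intro exI[of _ "\<lambda>p. ?c p \<in> A"]) auto
next
  let ?c = "\<lambda>p. mod_rel f `` {p}"
  assume "\<exists>c. (\<forall>p s. gcd s f \<in> D \<longrightarrow> c (p + s) = (\<not> c p)) \<and> (\<forall>p k. c (p + f * k) = c p)"
  then obtain c where c: "\<And>p s. gcd s f \<in> D \<Longrightarrow> c (p + s) = (\<not> c p)" "\<And>p k. c (p + f * k) = c p"
    by blast
  have cong: "c p = c q" if eq: "?c p = ?c q" for p q
  proof -
    obtain k where "p + q = f * k"
      using eq unfolding class_eq_iff by (elim dvdE)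
    then have "p + f * k = q"
      by (metis add.assoc add.left_neutral bit_poly_add_self)
    then show ?thesis
      using c(2)[of p k] by simp
  qed
  let ?A = "?c ` {p. c p}" and ?B = "?c ` {p. \<not> c p}"
  have "residue_classes f = ?A \<union> ?B"
    by (auto intro: class_in_residue_classes elim!: residue_classesE)
  moreover have "?A \<inter> ?B = {}"
    using cong by blast
  moreover have "parcs (gcd_graph f D) \<subseteq> ?A \<times> ?B \<union> ?B \<times> ?A"
  proof (rule subrelI)
    fix U V assume arc: "(U, V) \<in> parcs (gcd_graph f D)"
    then obtain u v where uv: "U = ?c u" "V = ?c v"
      by (auto simp: gcd_graph_def elim!: residue_classesE)
    with arc have "gcd (u + v) f \<in> D"
      using gcd_graph_arc_iff[of f u v D] by simp
    then have "c (u + (u + v)) = (\<not> c u)"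
      by (rule c)
    then have "c v = (\<not> c u)"
      by (simp flip: add.assoc)
    then show "(U, V) \<in> ?A \<times> ?B \<union> ?B \<times> ?A"
      unfolding uv by blast
  qed
  ultimately show "bipartite (with_proj (gcd_graph f D))"
    unfolding bipartite_def by (intro exI[of _ ?A] exI[of _ ?B]) (auto simp: gcd_graph_def)
qed

text \<open>
  Subsets of \<open>{0, e}\<close> are those that lie in a proper subgroup of the plane. If all of \<open>D\<close> were mapped
  into one, so would all polynomials be; but \<open>1\<close> and \<open>x\<close> have different nonzero images.
\<close>

lemma connected_imp_residues_span:
  assumes "f \<noteq> 0" "f \<notin> D" "xx1 dvd f"
    and "Digraph_Component.connected (with_proj (gcd_graph f D))"
  shows "\<not> residues ` D \<subseteq> {0, e}"
proof
  assume sub: "residues ` D \<subseteq> {0, e}"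
  have res_f: "residues (f * k) = 0" for k
    using \<open>xx1 dvd f\<close> by (simp flip: xx1_dvd_iff_residues)
  have all: "residues p \<in> {0, e}" for p
    using assms(1,2,4)
  proof (induction p rule: connected_gcd_graph_induct)
    case zero
    show ?case by (simp add: residues_def zero_prod_def)
  next
    case (add p s)
    then have "residues s \<in> {0, e}"
      using sub residues_gcd[OF \<open>xx1 dvd f\<close>, of s] imageI[of _ D residues] by fastforce
    with add show ?case
      by (auto simp: residues_add bit_pair_add_eq_0_iff)
  next
    case (cong p k)
    then show ?case
      by (auto simp: residues_add res_f)
  qed
  show False
    using all[of 1] all[of "[:0, 1:]"] by (auto simp: residues_def zero_prod_def)
qed

text \<open>
  The polynomials \<open>q\<close> such that adding \<open>x(x + 1)q\<close> keeps the colour are closed under sums and contain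
  the multiples of \<open>f\<close>. They contain every \<open>s = d * v\<close> with \<open>d = gcd s f \<in> D\<close> too: as \<open>x(x + 1)v\<close> is a sum of
  two units, \<open>x(x + 1)s\<close> is a sum of two unit multiples of \<open>d\<close>, each of which flips the colour.
\<close>

lemma colouring_factors_through_residues:
  assumes "f \<noteq> 0" "f \<notin> D"
    and D: "\<And>d. d \<in> D \<Longrightarrow> d dvd f"
    and "Digraph_Component.connected (with_proj (gcd_graph f D))"
    and c: "\<And>p s. gcd s f \<in> D \<Longrightarrow> c (p + s) = (\<not> c p)" "\<And>p k. c (p + f * k) = c p"
    and "residues p = residues q"
  shows "c p = c q"
proof -
  have multiple: "\<forall>p. c (p + xx1 * q) = c p" for q
    using assms(1,2,4)
  proof (induction q rule: connected_gcd_graph_induct)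
    case zero
    show ?case by simp
  next
    case (add q s)
    define d where "d = gcd s f"
    obtain v where v: "s = d * v"
      unfolding d_def by (metis dvdE gcd_dvd1)
    obtain u where u: "coprime u f" "coprime (u + xx1 * v) f"
      using multiple_of_xx1_eq_sum_of_two_units[OF \<open>f \<noteq> 0\<close>] dvd_triv_left by metis
    have "d \<in> D"
      using add by (simp add: d_def)
    then have S: "gcd (d * u) f \<in> D" "gcd (d * (u + xx1 * v)) f \<in> D"
      using u D by (simp_all only: gcd_mult_unit)
    show ?case
    proof
      fix p
      have "p + xx1 * (q + s) = p + xx1 * q + xx1 * s"
        by (simp only: distrib_left add.assoc)
      also have "xx1 * s = d * u + d * (u + xx1 * v)"
        unfolding v by (simp only: distrib_left mult.left_commute flip: add.assoc) simp
      finally have "c (p + xx1 * (q + s)) = c (p + xx1 * q + d * u + d * (u + xx1 * v))"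
        by (simp only: add.assoc)
      also have "\<dots> = c (p + xx1 * q)"
        using c(1)[OF S(1)] c(1)[OF S(2)] by blast
      finally show "c (p + xx1 * (q + s)) = c p"
        using add by blast
    qed
  next
    case (cong q k)
    have "p + xx1 * (q + f * k) = p + xx1 * q + f * (xx1 * k)" for p
      by (simp only: distrib_left mult.left_commute add.assoc)
    then show ?case
      using cong c(2) by metis
  qed
  obtain k where "p + q = xx1 * k"
    using assms(7) unfolding residues_eq_iff by (elim dvdE)
  then have "p + xx1 * k = q"
    by (metis add.assoc add.left_neutral bit_poly_add_self)
  then show ?thesis
    using multiple[of k] by metis
qed

section \<open>The bipartition theorem\<close>

text \<open>
  The complement of a line \<open>{0, e}\<close> is the other one of the two affine lines in its direction. It is
  \<open>{a, b}\<close> with \<open>a + b = e\<close>. Spanning rules out both a pair of points that contains \<open>0\<close> and a proper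
  subset of such a line.
\<close>

lemma card_eq_2_iff_affine_line:
  fixes R :: "(bit \<times> bit) set"
  assumes span: "\<And>e. \<not> R \<subseteq> {0, e}"
  shows "card R = 2 \<longleftrightarrow> (\<exists>e. e \<noteq> 0 \<and> R \<inter> {0, e} = {})"
proof
  assume "card R = 2"
  then obtain a b where R: "R = {a, b}" "a \<noteq> b"
    by (auto simp: card_2_iff)
  then have "a \<noteq> 0" "b \<noteq> 0"
    using span[of a] span[of b] by auto
  with R show "\<exists>e. e \<noteq> 0 \<and> R \<inter> {0, e} = {}"
    by (intro exI[of _ "a + b"]) (auto simp: bit_pair_add_eq_0_iff)
next
  assume "\<exists>e. e \<noteq> 0 \<and> R \<inter> {0, e} = {}"
  then obtain e where e: "e \<noteq> 0" "R \<inter> {0, e} = {}"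
    by blast
  have "(UNIV :: (bit \<times> bit) set) = {(0, 0), (0, 1), (1, 0), (1, 1)}"
    by (auto; metis bit.exhaust)
  then have "card (UNIV :: (bit \<times> bit) set) = card {(0, 0), (0, 1), (1, 0), (1, 1) :: bit \<times> bit}"
    by (rule arg_cong)
  also have "\<dots> = 4"
    by simp
  finally have "card (UNIV :: (bit \<times> bit) set) = 4" .
  then have "card (UNIV - {0, e}) = 2"
    using e by (simp add: card_Diff_subset)
  then obtain a b where ab: "UNIV - {0, e} = {a, b}" "a \<noteq> b"
    by (meson card_2_iff)
  then have "R \<subseteq> {a, b}"
    using e by blast
  with span[of a] span[of b] have "R = {a, b}"
    by blast
  with ab show "card R = 2"
    by simp
qed

theorem theorem4p4:
  fixes f :: "bit poly" and D :: "bit poly set"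
  assumes "f \<noteq> 0"
    and "[:0, 1:] * ([:0, 1:] + 1) dvd f"
    and "D \<noteq> {}"
    and "\<And>d. d \<in> D \<Longrightarrow> d dvd f"
    and "f \<notin> D"
    and "Digraph_Component.connected (with_proj (gcd_graph f D))"
  shows "bipartite (with_proj (gcd_graph f D)) \<longleftrightarrow>
    card ((\<lambda>d. gcd d ([:0, 1:] * ([:0, 1:] + 1))) ` D) = 2"
proof -
  have "xx1 dvd f"
    using assms(2) by (simp add: xx1_def)
  have span: "\<not> residues ` D \<subseteq> {0, e}" for e
    using connected_imp_residues_span \<open>xx1 dvd f\<close> assms by blast
  have "bipartite (with_proj (gcd_graph f D)) \<longleftrightarrow>
    (\<exists>e. e \<noteq> 0 \<and> residues ` D \<inter> {0, e} = {})"
  proof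
    assume "bipartite (with_proj (gcd_graph f D))"
    then obtain c where c: "\<And>p s. gcd s f \<in> D \<Longrightarrow> c (p + s) = (\<not> c p)"
        "\<And>p k. c (p + f * k) = c p"
      unfolding bipartite_gcd_graph_iff by blast
    have factor: "c p = c q" if "residues p = residues q" for p q
      using colouring_factors_through_residues[OF assms(1,5,4,6) c that] .
    have flip: "c (p + d) = (\<not> c p)" if "d \<in> D" for p d
    proof -
      have "gcd d f = d"
        using assms(4)[OF that] by (metis gcd_proj1_iff normalize_bit_poly)
      with that show ?thesis
        by (simp add: c(1))
    qed
    show "\<exists>e. e \<noteq> 0 \<and> residues ` D \<inter> {0, e} = {}"
    proof (rule ccontr)
      assume none: "\<not> ?thesis"
      have "residues 0 = 0"
        by (simp add: residues_def zero_prod_def)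
      then have nonzero: "residues d \<noteq> 0" if "d \<in> D" for d
        using factor[of d 0] flip[OF that, of 0] by auto
      have hit: "\<exists>d \<in> D. residues d = e" if "e \<noteq> 0" for e
      proof (rule ccontr)
        assume "\<not> ?thesis"
        with nonzero have "residues ` D \<inter> {0, e} = {}"
          by blast
        with none \<open>e \<noteq> 0\<close> show False
          by blast
      qed
      obtain d1 d2 d3 where d: "d1 \<in> D" "d2 \<in> D" "d3 \<in> D"
        and r: "residues d1 = (0, 1)" "residues d2 = (1, 0)" "residues d3 = (1, 1)"
        using hit[of "(0, 1)"] hit[of "(1, 0)"] hit[of "(1, 1)"] by (auto simp: zero_prod_def)
      \<comment> \<open>The three points add up to \<open>0\<close>, whereas adding the three divisors flips the colour.\<close>
      from r have "residues (0 + d1 + d2 + d3) = residues 0"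
        by (simp only: residues_add) (simp add: zero_prod_def residues_def)
      then show False
        using factor flip d by blast
    qed
  next
    assume "\<exists>e. e \<noteq> 0 \<and> residues ` D \<inter> {0, e} = {}"
    then obtain e where e: "e \<noteq> 0" "residues ` D \<inter> {0, e} = {}"
      by blast
    show "bipartite (with_proj (gcd_graph f D))"
      unfolding bipartite_gcd_graph_iff
    proof (intro exI[of _ "\<lambda>p. residues p \<in> {0, e}"] conjI allI impI)
      fix p s assume "gcd s f \<in> D"
      then have "residues s \<notin> {0, e}"
        using e(2) residues_gcd[OF \<open>xx1 dvd f\<close>, of s] by (metis IntI emptyE imageI)
      with e(1) show "(residues (p + s) \<in> {0, e}) = (residues p \<notin> {0, e})"
        unfolding residues_add by (rule bit_pair_add_in_subgroup_iff)
    next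
      fix p k
      have "residues (f * k) = 0"
        using \<open>xx1 dvd f\<close> by (simp flip: xx1_dvd_iff_residues)
      then show "(residues (p + f * k) \<in> {0, e}) = (residues p \<in> {0, e})"
        by (simp add: residues_add)
    qed
  qed
  also have "\<dots> \<longleftrightarrow> card (residues ` D) = 2"
    using card_eq_2_iff_affine_line[OF span] by blast
  also have "\<dots> \<longleftrightarrow> card ((\<lambda>d. gcd d ([:0, 1:] * ([:0, 1:] + 1))) ` D) = 2"
    using card_image_gcd_xx1[of D] by (simp only: xx1_def)
  finally show ?thesis .
qed

end
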